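(* Let $(\Omega,\mathcal{F},(\mathcal{F}_n)_{n\in\mathbb{N}_0},\mathbb{P})$ be a filtered probability space and let $(M_n)_{n\in\mathbb{N}_0}$ be an $(\mathcal{F}_n)_{n\in\mathbb{N}_0}$-martingale (real-valued) satisfying $M_0=0$. Let $(X_n)_{n\in\mathbb{N}_0}$, $(F_n)_{n\in\mathbb{N}_0}$, and $(G_n)_{n\in\mathbb{N}_0}$ be sequences of nonnegative real-valued random variables adapted to $(\mathcal{F}_n)_{n\in\mathbb{N}_0}$, with $\mathbb{E}[X_0]<\infty$, such that $$X_n\le F_n+M_n+\sum_{k=0}^{n-1}G_kX_k\quad\text{for all } n\in\mathbb{N}_0.$$ Then, for any $p\in(0,1)$ and $\mu,\nu\in[1,\infty]$ with $\frac1\mu+\frac1\nu=1$ and $p\nu<1$, it holds that $$\mathbb{E}\Big[\sup_{0\le k\le n}X_k^p\Big]\le\Big(1+\frac{1}{1-\nu p}\Big)^{\frac1\nu}\,\Big\|\prod_{k=0}^{n-1}(1+G_k)^p\Big\|_{L^\mu(\Omega)}\Big(\mathbb{E}\Big[\sup_{0\le k\le n}F_k\Big]\Big)^p$$ for all $n\in\mathbb{N}_0$. In particular, if $(G_n)_{n\in\mathbb{N}_0}$ is a deterministic sequence of nonnegative real numbers, then for any $p\in(0,1)$ it holds that $$\mathbb{E}\Big[\sup_{0\le k\le n}X_k^p\Big]\le\Big(1+\frac{1}{1-p}\Big)\Big(\prod_{k=0}^{n-1}(1+G_k)^p\Big)\Big(\mathbb{E}\Big[\sup_{0\le k\le n}F_k\Big]\Big)^p$$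 for all $n\in\mathbb{N}_0$.
   Context: $\mathbb{N}_0=\{0,1,2,\ldots\}$. Sums over empty index sets equal zero and products over empty index sets equal one. The case $\mu=\infty$, $\nu=1$ is allowed (with $\frac1\infty=0$ and $L^\infty(\Omega)$ carrying the essential supremum norm). Expectations and norms of nonnegative random variables may take the value $+\infty$. *)

theory Defs
  imports "HOL-Probability.Probability"
begin

definition filtered_prob_space :: "'a measure \<Rightarrow> (nat \<Rightarrow> 'a measure) \<Rightarrow> bool" where
  "filtered_prob_space P Fil \<longleftrightarrow>
     prob_space P \<and> filtration (space P) Fil \<and> (\<forall>n. subalgebra P (Fil n))"

definition adapted_process :: "(nat \<Rightarrow> 'a measure) \<Rightarrow> (nat \<Rightarrow> 'a \<Rightarrow> real) \<Rightarrow> bool" where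
  "adapted_process Fil X \<longleftrightarrow> (\<forall>n. X n \<in> borel_measurable (Fil n))"

definition nonneg_process :: "'a measure \<Rightarrow> (nat \<Rightarrow> 'a \<Rightarrow> real) \<Rightarrow> bool" where
  "nonneg_process P X \<longleftrightarrow> (\<forall>n. \<forall>\<omega>\<in>space P. 0 \<le> X n \<omega>)"

definition martingale_process ::
    "'a measure \<Rightarrow> (nat \<Rightarrow> 'a measure) \<Rightarrow> (nat \<Rightarrow> 'a \<Rightarrow> real) \<Rightarrow> bool" where
  "martingale_process P Fil M \<longleftrightarrow>
     adapted_process Fil M \<and> (\<forall>n. integrable P (M n)) \<and>
     (\<forall>m n. m \<le> n \<longrightarrow> (AE \<omega> in P. real_cond_exp P (Fil m) (M n) \<omega> = M m \<omega>))"

text \<open>Real powers of extended nonnegative numbers, meant for exponents \<open>r > 0\<close> only,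
  so that the power of infinity is infinity.\<close>

definition ennreal_powr :: "ennreal \<Rightarrow> real \<Rightarrow> ennreal" where
  "ennreal_powr x r = (if x = \<infinity> then \<infinity> else ennreal (enn2real x powr r))"

text \<open>The norm of a random variable in \<open>L\<^sup>\<mu>\<close>, for \<open>\<mu>\<close> in \<open>[1, \<infinity>]\<close>; it is infinite
  if the random variable does not belong to this space.\<close>

definition Lp_norm :: "'a measure \<Rightarrow> ennreal \<Rightarrow> ('a \<Rightarrow> real) \<Rightarrow> ennreal" where
  "Lp_norm P \<mu> Y =
     (if \<mu> = \<infinity> then esssup P (\<lambda>\<omega>. ennreal \<bar>Y \<omega>\<bar>)
      else ennreal_powr (\<integral>\<^sup>+\<omega>. ennreal (\<bar>Y \<omega>\<bar> powr enn2real \<mu>) \<partial>P) (1 / enn2real \<mu>))"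

end

(*
  Put A_n = prod_{k<n} (1 + G_k). Dividing the recursion by A_n turns the Gronwall sum into
  the pathwise bound X_n / A_n <= max_{k<=n} F_k + L_n, where
  L_n = sum_{k<n} (M_{k+1} - M_k) / A_{k+1} is a martingale transform with weights in [0,1],
  hence a martingale. Stopping at the first time when W = X / A reaches a level x gives the
  weak-type estimate x * P(max_{k<=n} W_k >= x) <= E[max_{k<=n} F_k] =: a. Integrating over x
  yields E[(max W)^q] <= a^q / (1 - q) for 0 < q < 1, and Hoelder's inequality applied to
  max X^p <= A_n^p (max W)^p, with q = nu p, finishes the proof.
*)

theory Submission
  imports Defs
begin

section \<open>Pathwise inequalities for real sequences\<close>

text \<open>One step multiplies the right-hand side of the recursion by at most
  \<open>1 + g n\<close> and adds the increments of \<open>f\<close> and \<open>m\<close>. Dividing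
  by the product of these factors cancels the multiplication, so only discounted increments
  accumulate. Those of \<open>f\<close> are nonnegative and may lose their discount; those of
  \<open>m\<close> have no sign and keep it.\<close>

lemma discounted_gronwall:
  fixes x f m g :: "nat \<Rightarrow> real"
  assumes g: "\<And>k. 0 \<le> g k" and "mono f" and "m 0 = 0"
    and le: "\<And>n. x n \<le> f n + m n + (\<Sum>k<n. g k * x k)"
  shows "x n / (\<Prod>k<n. 1 + g k)
    \<le> f n + (\<Sum>k<n. 1 / (\<Prod>j<Suc k. 1 + g j) * (m (Suc k) - m k))"
proof -
  define A where "A n = (\<Prod>k<n. 1 + g k)" for n
  \<comment> \<open>The induction runs on the majorant \<open>z\<close>, whose increments are known
    exactly, while \<open>x\<close> satisfies nothing but \<open>x n \<le> z n\<close>.\<close>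
  define z where "z n = f n + m n + (\<Sum>k<n. g k * x k)" for n
  have A1: "1 \<le> A n" for n
    unfolding A_def by (intro prod_ge_1) (simp add: g)
  then have Apos: "0 < A n" for n
    by (rule less_le_trans[OF zero_less_one])
  have "z n / A n \<le> f n + (\<Sum>k<n. 1 / A (Suc k) * (m (Suc k) - m k))" for n
  proof (induction n)
    case 0
    then show ?case
      by (simp add: z_def A_def \<open>m 0 = 0\<close>)
  next
    case (Suc n)
    have f: "0 \<le> f (Suc n) - f n"
      using \<open>mono f\<close> by (simp add: monoD)
    have AS: "A (Suc n) = A n * (1 + g n)"
      by (simp add: A_def)
    have "g n * x n \<le> g n * z n"
      using g[of n] le[of n] by (intro mult_left_mono) (simp_all add: z_def)
    then have "z (Suc n) \<le> (1 + g n) * z n + (f (Suc n) - f n) + (m (Suc n) - m n)"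
      by (simp add: z_def[of "Suc n"]) (simp add: z_def[of n] algebra_simps)
    then have "z (Suc n) / A (Suc n)
        \<le> ((1 + g n) * z n + (f (Suc n) - f n) + (m (Suc n) - m n)) / A (Suc n)"
      using Apos[of "Suc n"] by (intro divide_right_mono) auto
    also have "\<dots> = z n / A n + (f (Suc n) - f n) / A (Suc n)
        + 1 / A (Suc n) * (m (Suc n) - m n)"
      using g[of n] Apos[of n] by (simp add: add_divide_distrib AS)
    \<comment> \<open>Here monotonicity of \<open>f\<close> enters: a nonnegative increment only
      grows when its weight, at most 1, is replaced by 1. The increments of \<open>f\<close> then
      telescope.\<close>
    also have "(f (Suc n) - f n) / A (Suc n) \<le> f (Suc n) - f n"
      using f A1[of "Suc n"] Apos[of "Suc n"] by (simp add: divide_le_eq mult_le_cancel_left1)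
    finally show ?case
      using Suc by simp
  qed
  moreover have "x n / A n \<le> z n / A n"
    using le[of n] Apos[of n] by (simp add: z_def divide_right_mono)
  ultimately show ?thesis
    unfolding A_def by (meson order_trans)
qed

text \<open>The sum on the right is the sum of \<open>d\<close> stopped at the first index
  \<open>m\<close> with \<open>x \<le> w m\<close>. If there is such an index up to
  \<open>n\<close>, the bound is \<open>le\<close> at \<open>m\<close> with
  \<open>f m \<le> f n\<close>; otherwise nothing is stopped and \<open>0 \<le> w n\<close>
  suffices.\<close>

lemma stopped_sum_bound:
  fixes w f d :: "nat \<Rightarrow> real"
  assumes "mono f" and w: "\<And>k. 0 \<le> w k" and le: "\<And>k. w k \<le> f k + (\<Sum>j<k. d j)"
  shows "(if \<exists>k\<le>n. x \<le> w k then x else 0)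
    \<le> f n + (\<Sum>k<n. (if \<forall>j\<le>k. w j < x then d k else 0))"
proof (cases "\<exists>k\<le>n. x \<le> w k")
  case True
  define m where "m = (LEAST k. x \<le> w k)"
  from True obtain k where k: "k \<le> n" "x \<le> w k" by blast
  then have m: "x \<le> w m" "m \<le> n"
    unfolding m_def by (auto intro: LeastI Least_le order_trans)
  \<comment> \<open>The increment \<open>d k\<close>, leading from time \<open>k\<close> to
    \<open>k + 1\<close>, survives exactly when the level has not been reached by time
    \<open>k\<close>. The stopped sum thus ends with \<open>d (m - 1)\<close> and matches the bound
    for \<open>w m\<close>.\<close>
  have "(\<forall>j\<le>k. w j < x) \<longleftrightarrow> k < m" for k
    using m(1) not_less_Least[of _ "\<lambda>k. x \<le> w k"] unfolding m_def[symmetric]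
    by (meson leI le_less_trans not_le)
  then have "(\<Sum>k<n. (if \<forall>j\<le>k. w j < x then d k else 0)) = (\<Sum>k<n. (if k < m then d k else 0))"
    by simp
  also have "\<dots> = (\<Sum>k<m. d k)"
    using m(2) by (intro sum.mono_neutral_cong_right) auto
  finally show ?thesis
    using True m(1) le[of m] monoD[OF \<open>mono f\<close> m(2)] by simp
next
  case False
  then have "\<forall>j\<le>k. w j < x" if "k < n" for k
    using that by (meson leI le_less_trans less_imp_le)
  then have "(\<Sum>k<n. (if \<forall>j\<le>k. w j < x then d k else 0)) = (\<Sum>k<n. d k)"
    by (intro sum.cong) auto
  then show ?thesis
    unfolding if_not_P[OF False] using le[of n] w[of n] by simp
qed

section \<open>From tail bounds to moments, and Hoelder's inequality\<close>

text \<open>Layer-cake formula cut at the level \<open>a\<close>. Below \<open>a\<close> the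
  integrand is at most \<open>a powr q\<close>; above it, the tail bound turns the density
  \<open>q * x powr (q - 1)\<close> into \<open>q * a * x powr (q - 2)\<close>, which is integrable
  at infinity because \<open>q < 1\<close>. The two parts contribute \<open>a powr q\<close> times 1
  and times \<open>q / (1 - q)\<close>.\<close>

lemma nn_integral_powr_le_of_weak_bound:
  fixes S :: "'a \<Rightarrow> real"
  assumes "prob_space P" and [measurable]: "S \<in> borel_measurable P"
    and S0: "\<And>\<omega>. \<omega> \<in> space P \<Longrightarrow> 0 \<le> S \<omega>"
    and a: "0 < a" and q: "0 < q" "q < 1"
    and tail: "\<And>x. a \<le> x \<Longrightarrow> emeasure P {\<omega> \<in> space P. x \<le> S \<omega>} \<le> ennreal (a / x)"
  shows "(\<integral>\<^sup>+\<omega>. ennreal (S \<omega> powr q) \<partial>P) \<le> ennreal (a powr q / (1 - q))"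
proof -
  interpret prob_space P by fact
  interpret pair_sigma_finite P lborel ..
  define h where "h x = q * x powr (q - 1)" for x :: real
  have [measurable]: "h \<in> borel_measurable borel"
    unfolding h_def by measurable
  have h0: "0 \<le> h x" for x
    using q by (simp add: h_def)
  have deriv: "((\<lambda>x. x powr q) has_real_derivative h x) (at x)" if "a \<le> x" for x
    using that a unfolding h_def by (auto intro!: derivative_eq_intros)
  \<comment> \<open>Starting the integral at \<open>a > 0\<close> keeps the fundamental theorem of
    calculus away from 0, where \<open>h\<close> has its singularity. If \<open>S\<close> is below
    \<open>a\<close>, the first summand alone suffices.\<close>
  have cake: "ennreal (S \<omega> powr q) \<le> ennreal (a powr q) +
      (\<integral>\<^sup>+x. ennreal (h x) * indicator {a..} x * indicator {..S \<omega>} x \<partial>lborel)"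
    if "\<omega> \<in> space P" for \<omega>
  proof (cases "S \<omega> < a")
    case True
    then have "ennreal (S \<omega> powr q) \<le> ennreal (a powr q)"
      using S0[OF that] q by (intro ennreal_leI powr_mono2) auto
    then show ?thesis
      by (rule order_trans) simp
  next
    case False
    then have "(\<integral>\<^sup>+x. ennreal (h x) * indicator {a..S \<omega>} x \<partial>lborel)
        = ennreal (S \<omega> powr q - a powr q)"
      using h0 deriv by (intro nn_integral_FTC_Icc) auto
    moreover have "(\<integral>\<^sup>+x. ennreal (h x) * indicator {a..} x * indicator {..S \<omega>} x \<partial>lborel)
        = (\<integral>\<^sup>+x. ennreal (h x) * indicator {a..S \<omega>} x \<partial>lborel)"
      by (intro nn_integral_cong) (auto split: split_indicator)
    moreover have "a powr q \<le> S \<omega> powr q"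
      using False a q by (intro powr_mono2) auto
    ultimately show ?thesis
      by (simp flip: ennreal_plus)
  qed
  have "(\<integral>\<^sup>+\<omega>. ennreal (S \<omega> powr q) \<partial>P) \<le> (\<integral>\<^sup>+\<omega>. ennreal (a powr q) +
      (\<integral>\<^sup>+x. ennreal (h x) * indicator {a..} x * indicator {..S \<omega>} x \<partial>lborel) \<partial>P)"
    by (intro nn_integral_mono cake)
  also have "\<dots> = (\<integral>\<^sup>+\<omega>. ennreal (a powr q) \<partial>P) +
      (\<integral>\<^sup>+\<omega>. (\<integral>\<^sup>+x. ennreal (h x) * indicator {a..} x * indicator {..S \<omega>} x \<partial>lborel) \<partial>P)"
    by (intro nn_integral_add) (simp_all add: indicator_def)
  also have "(\<integral>\<^sup>+\<omega>. ennreal (a powr q) \<partial>P) = ennreal (a powr q)"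
    by (simp add: emeasure_space_1)
  \<comment> \<open>Tonelli: with the order of integration exchanged, the inner integral becomes a
    tail probability of \<open>S\<close>.\<close>
  also have "(\<integral>\<^sup>+\<omega>. (\<integral>\<^sup>+x. ennreal (h x) * indicator {a..} x * indicator {..S \<omega>} x \<partial>lborel) \<partial>P)
      = (\<integral>\<^sup>+x. (\<integral>\<^sup>+\<omega>. ennreal (h x) * indicator {a..} x * indicator {..S \<omega>} x \<partial>P) \<partial>lborel)"
    by (intro Fubini'[symmetric]) (simp add: indicator_def)
  also have "\<dots> \<le> (\<integral>\<^sup>+x. ennreal (q * a * x powr (q - 2)) * indicator {a..} x \<partial>lborel)"
  proof (intro nn_integral_mono)
    fix x :: real
    show "(\<integral>\<^sup>+\<omega>. ennreal (h x) * indicator {a..} x * indicator {..S \<omega>} x \<partial>P)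
        \<le> ennreal (q * a * x powr (q - 2)) * indicator {a..} x"
    proof (cases "a \<le> x")
      case True
      have "(\<integral>\<^sup>+\<omega>. ennreal (h x) * indicator {a..} x * indicator {..S \<omega>} x \<partial>P)
          = (\<integral>\<^sup>+\<omega>. ennreal (h x) * indicator {\<omega> \<in> space P. x \<le> S \<omega>} \<omega> \<partial>P)"
        using True by (intro nn_integral_cong) (auto split: split_indicator)
      also have "\<dots> = ennreal (h x) * emeasure P {\<omega> \<in> space P. x \<le> S \<omega>}"
        by (intro nn_integral_cmult_indicator) measurable
      also have "\<dots> \<le> ennreal (h x) * ennreal (a / x)"
        by (intro mult_left_mono tail True) simp
      also have "\<dots> = ennreal (h x * (a / x))"
        using True a h0 by (intro ennreal_mult[symmetric]) auto
      also have "h x * (a / x) = q * a * x powr (q - 2)"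
        using True a powr_minus_divide[of x 1] powr_add[of x "q - 1" "-1"] by (simp add: h_def)
      finally show ?thesis
        using True by simp
    qed simp
  qed
  \<comment> \<open>An antiderivative is a negative multiple of \<open>x powr (q - 1)\<close>; it
    vanishes at infinity since \<open>q - 1 < 0\<close>, so only its value at \<open>a\<close>
    remains.\<close>
  also have "\<dots> = ennreal (0 - (- (q * a / (1 - q) * a powr (q - 1))))"
  proof (rule nn_integral_FTC_atLeast[where F = "\<lambda>x. - (q * a / (1 - q) * x powr (q - 1))"])
    fix x assume x: "a \<le> x"
    have "((\<lambda>x. - (K * x powr (q - 1))) has_real_derivative
        - (K * ((q - 1) * x powr (q - 1 - 1)))) (at x)" for K
      using x a by (auto intro!: derivative_eq_intros)
    moreover have "- (q * a / (1 - q) * ((q - 1) * y)) = q * a * y" for y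
      using q by (simp add: field_simps)
    moreover have "q - 1 - 1 = q - 2"
      by simp
    ultimately
    show "((\<lambda>x. - (q * a / (1 - q) * x powr (q - 1))) has_real_derivative
        q * a * x powr (q - 2)) (at x)"
      by metis
    show "0 \<le> q * a * x powr (q - 2)"
      using a q by simp
  next
    have "((\<lambda>x. x powr (q - 1)) \<longlongrightarrow> 0) at_top"
      using q by (intro tendsto_neg_powr filterlim_ident) auto
    from tendsto_minus[OF tendsto_mult_left[OF this, of "q * a / (1 - q)"]]
    show "((\<lambda>x. - (q * a / (1 - q) * x powr (q - 1))) \<longlongrightarrow> 0) at_top"
      by simp
  qed simp
  also have "ennreal (a powr q) + \<dots> = ennreal (a powr q + q * a / (1 - q) * a powr (q - 1))"
    using a q by (simp add: ennreal_plus)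
  also have "a powr q + q * a / (1 - q) * a powr (q - 1) = a powr q / (1 - q)"
    using a q powr_add[of a 1 "q - 1"] by (simp add: field_simps)
  finally show ?thesis
    by (simp add: add_left_mono)
qed

text \<open>Young's inequality for the normalised functions \<open>f / a\<close> and
  \<open>g / b\<close>, integrated; the weights add up to \<open>1 / u + 1 / v = 1\<close>. Working
  with positive bounds \<open>a\<close> and \<open>b\<close> instead of the norms themselves avoids
  division by a vanishing norm.\<close>

lemma Hoelder_bound:
  fixes f g :: "'a \<Rightarrow> real"
  assumes [measurable]: "f \<in> borel_measurable M" "g \<in> borel_measurable M"
    and nonneg: "\<And>x. x \<in> space M \<Longrightarrow> 0 \<le> f x" "\<And>x. x \<in> space M \<Longrightarrow> 0 \<le> g x"
    and uv: "1 < u" "1 < v" "1 / u + 1 / v = 1" and ab: "0 < a" "0 < b"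
    and f: "(\<integral>\<^sup>+x. ennreal (f x powr u) \<partial>M) \<le> ennreal (a powr u)"
    and g: "(\<integral>\<^sup>+x. ennreal (g x powr v) \<partial>M) \<le> ennreal (b powr v)"
  shows "(\<integral>\<^sup>+x. ennreal (f x * g x) \<partial>M) \<le> ennreal (a * b)"
proof -
  \<comment> \<open>\<open>c\<close> and \<open>d\<close> are the coefficients in Young's inequality
    for \<open>f x / a\<close> and \<open>g x / b\<close> after multiplication by
    \<open>a * b\<close>.\<close>
  define c where "c = a * b / u * (1 / a powr u)"
  define d where "d = a * b / v * (1 / b powr v)"
  have cd: "0 \<le> c" "0 \<le> d"
    using ab uv by (simp_all add: c_def d_def)
  have "f x * g x \<le> c * f x powr u + d * g x powr v" if "x \<in> space M" for x
  proof -
    have "f x / a * (g x / b) \<le> (f x / a) powr u / u + (g x / b) powr v / v"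
      using nonneg[OF that] ab uv by (intro Youngs_inequality) auto
    then have "a * b * (f x / a * (g x / b))
        \<le> a * b * ((f x / a) powr u / u + (g x / b) powr v / v)"
      using ab by (intro mult_left_mono) auto
    then show ?thesis
      using nonneg[OF that] ab by (simp add: powr_divide c_def d_def algebra_simps)
  qed
  then have "(\<integral>\<^sup>+x. ennreal (f x * g x) \<partial>M)
      \<le> (\<integral>\<^sup>+x. ennreal c * ennreal (f x powr u) + ennreal d * ennreal (g x powr v) \<partial>M)"
    using cd by (intro nn_integral_mono) (simp flip: ennreal_plus ennreal_mult)
  also have "\<dots> = ennreal c * (\<integral>\<^sup>+x. ennreal (f x powr u) \<partial>M)
      + ennreal d * (\<integral>\<^sup>+x. ennreal (g x powr v) \<partial>M)"
    by (simp add: nn_integral_add nn_integral_cmult)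
  also have "\<dots> \<le> ennreal c * ennreal (a powr u) + ennreal d * ennreal (b powr v)"
    using f g by (intro add_mono mult_left_mono) auto
  also have "\<dots> = ennreal (a * b / u + a * b / v)"
    using cd ab uv by (simp add: c_def d_def flip: ennreal_plus ennreal_mult)
  also have "a * b / u + a * b / v = a * b * (1 / u + 1 / v)"
    by (simp only: distrib_left times_divide_eq_right mult_1_right)
  finally show ?thesis
    by (simp add: uv)
qed


section \<open>Martingale transforms and the maximal inequality\<close>

lemma integrable_bounded_mult:
  fixes f h :: "'a \<Rightarrow> real"
  assumes "integrable M f" and [measurable]: "h \<in> borel_measurable M"
    and h: "\<And>x. x \<in> space M \<Longrightarrow> \<bar>h x\<bar> \<le> 1"
  shows "integrable M (\<lambda>x. h x * f x)"
proof (rule Bochner_Integration.integrable_bound[OF \<open>integrable M f\<close>])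
  have [measurable]: "f \<in> borel_measurable M"
    using \<open>integrable M f\<close> by simp
  show "(\<lambda>x. h x * f x) \<in> borel_measurable M"
    by measurable
  show "AE x in M. norm (h x * f x) \<le> norm (f x)"
    using h by (intro AE_I2) (simp add: abs_mult mult_left_le_one_le)
qed

text \<open>A weight known at time \<open>k\<close> can be moved through the conditional expectation
  given \<open>Fil k\<close>, which turns \<open>M (Suc k)\<close> into \<open>M k\<close>. Its
  boundedness keeps the products integrable.\<close>

lemma martingale_increment_orthogonal:
  assumes P: "filtered_prob_space P Fil" and M: "martingale_process P Fil M"
    and h: "h \<in> borel_measurable (Fil k)" "\<And>\<omega>. \<omega> \<in> space P \<Longrightarrow> \<bar>h \<omega>\<bar> \<le> 1"
  shows "integrable P (\<lambda>\<omega>. h \<omega> * (M (Suc k) \<omega> - M k \<omega>))"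
    and "(\<integral>\<omega>. h \<omega> * (M (Suc k) \<omega> - M k \<omega>) \<partial>P) = 0"
proof -
  have sub: "subalgebra P (Fil k)" and prob: "prob_space P"
    using P by (simp_all add: filtered_prob_space_def)
  interpret prob_space P by fact
  interpret finite_measure_subalgebra P "Fil k"
    by unfold_locales fact
  have int: "integrable P (M j)" for j
    using M by (simp add: martingale_process_def)
  then have [measurable]: "M j \<in> borel_measurable P" for j
    by simp
  have [measurable]: "h \<in> borel_measurable P"
    by (rule measurable_from_subalg[OF sub h(1)])
  have hM: "integrable P (\<lambda>\<omega>. h \<omega> * M j \<omega>)" for j
    by (intro integrable_bounded_mult int h(2)) measurable
  have "(\<integral>\<omega>. h \<omega> * M (Suc k) \<omega> \<partial>P) = (\<integral>\<omega>. h \<omega> * real_cond_exp P (Fil k) (M (Suc k)) \<omega> \<partial>P)"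
    by (intro real_cond_exp_intg(2)[symmetric] hM h(1)) measurable
  also have "\<dots> = (\<integral>\<omega>. h \<omega> * M k \<omega> \<partial>P)"
  proof (intro integral_cong_AE)
    have "AE \<omega> in P. real_cond_exp P (Fil k) (M (Suc k)) \<omega> = M k \<omega>"
      using M by (simp add: martingale_process_def)
    then show "AE \<omega> in P. h \<omega> * real_cond_exp P (Fil k) (M (Suc k)) \<omega> = h \<omega> * M k \<omega>"
      by eventually_elim simp
  qed measurable
  finally show "(\<integral>\<omega>. h \<omega> * (M (Suc k) \<omega> - M k \<omega>) \<partial>P) = 0"
    using hM by (simp add: right_diff_distrib)
  show "integrable P (\<lambda>\<omega>. h \<omega> * (M (Suc k) \<omega> - M k \<omega>))"
    using hM by (simp add: right_diff_distrib)
qed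

lemma filtered_prob_space_measurable_mono:
  assumes "filtered_prob_space P Fil" "f \<in> measurable (Fil j) N" "j \<le> k"
  shows "f \<in> measurable (Fil k) N"
  using assms filtration.space_F[of "space P" Fil] filtration.sets_F_mono[of "space P" Fil j k]
  by (intro measurable_from_subalg[of "Fil k" "Fil j"])
    (auto simp: filtered_prob_space_def subalgebra_def)

lemma adapted_process_measurable:
  assumes "filtered_prob_space P Fil" "adapted_process Fil X"
  shows "X k \<in> borel_measurable P" and "j \<le> k \<Longrightarrow> X j \<in> borel_measurable (Fil k)"
proof -
  show "X k \<in> borel_measurable P"
    using assms measurable_from_subalg[of P "Fil k" "X k"]
    unfolding filtered_prob_space_def adapted_process_def by blast
  show "X j \<in> borel_measurable (Fil k)" if "j \<le> k"
    using filtered_prob_space_measurable_mono[OF assms(1) _ that] assms(2)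
    unfolding adapted_process_def by blast
qed

text \<open>A Doob-type argument: stopping the transform when \<open>W\<close> first reaches
  \<open>x\<close> leaves a sum \<open>N\<close> of mean zero with
  \<open>x * indicator E \<le> f n + N\<close> almost surely. Taking expectations bounds
  \<open>x\<close> times the probability of \<open>E\<close> by \<open>a\<close>.\<close>

lemma maximal_inequality:
  fixes W f B M :: "nat \<Rightarrow> 'a \<Rightarrow> real"
  assumes P: "filtered_prob_space P Fil" and M: "martingale_process P Fil M"
    and W: "adapted_process Fil W" "nonneg_process P W"
    and B: "adapted_process Fil B" "\<And>k \<omega>. \<omega> \<in> space P \<Longrightarrow> \<bar>B k \<omega>\<bar> \<le> 1"
    and f: "f n \<in> borel_measurable P" "nonneg_process P f"
      "\<And>\<omega>. \<omega> \<in> space P \<Longrightarrow> mono (\<lambda>k. f k \<omega>)"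
    and le: "\<And>k. AE \<omega> in P. W k \<omega> \<le> f k \<omega> + (\<Sum>j<k. B j \<omega> * (M (Suc j) \<omega> - M j \<omega>))"
    and a: "0 \<le> a" "(\<integral>\<^sup>+\<omega>. ennreal (f n \<omega>) \<partial>P) \<le> ennreal a" and x: "0 < x"
  shows "emeasure P {\<omega> \<in> space P. \<exists>k\<le>n. x \<le> W k \<omega>} \<le> ennreal (a / x)"
proof -
  interpret prob_space P
    using P by (simp add: filtered_prob_space_def)
  define E where "E = {\<omega> \<in> space P. \<exists>k\<le>n. x \<le> W k \<omega>}"
  \<comment> \<open>The weight \<open>B\<close> is switched off from the first passage onwards.
    Whether this has happened by time \<open>k\<close> is decided by \<open>W 0\<close> to
    \<open>W k\<close>, so \<open>h k\<close> may multiply the increment from \<open>k\<close> to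
    \<open>k + 1\<close>.\<close>
  define h where "h k \<omega> = (if \<forall>j\<le>k. W j \<omega> < x then B k \<omega> else 0)" for k \<omega>
  have h1: "\<bar>h k \<omega>\<bar> \<le> 1" if "\<omega> \<in> space P" for k \<omega>
    using B(2)[OF that] by (simp add: h_def)
  have h_meas: "h k \<in> borel_measurable (Fil k)" for k
  proof -
    have B_k: "B k \<in> borel_measurable (Fil k)"
      using B(1) by (simp add: adapted_process_def)
    have W_k: "W j \<in> borel_measurable (Fil k)" if "j \<le> k" for j
      by (rule adapted_process_measurable(2)[OF P W(1) that])
    have "{\<omega> \<in> space (Fil k). \<forall>j\<in>{..k}. W j \<omega> < x} \<in> sets (Fil k)"
    proof (intro sets.sets_Collect_finite_All)
      show "{\<omega> \<in> space (Fil k). W j \<omega> < x} \<in> sets (Fil k)" if "j \<in> {..k}" for j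
        using W_k[of j] that by (intro borel_measurable_less) auto
    qed simp
    then have "{\<omega> \<in> space (Fil k). \<forall>j\<le>k. W j \<omega> < x} \<in> sets (Fil k)"
      by (simp only: Ball_def atMost_iff)
    from measurable_If[OF B_k borel_measurable_const this, of 0] show ?thesis
      unfolding h_def[abs_def] .
  qed
  have [measurable]: "W k \<in> borel_measurable P" for k
    by (rule adapted_process_measurable(1)[OF P W(1)])
  have [measurable]: "E \<in> sets P"
    unfolding E_def by measurable
  define N where "N \<omega> = (\<Sum>k<n. h k \<omega> * (M (Suc k) \<omega> - M k \<omega>))" for \<omega>
  note h_int = martingale_increment_orthogonal[OF P M h_meas h1]
  have N: "integrable P N" "(\<integral>\<omega>. N \<omega> \<partial>P) = 0"
    unfolding N_def using h_int by simp_all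
  \<comment> \<open>Since \<open>N\<close> changes sign, expectations of \<open>f n + N\<close> are
    taken with the Bochner integral, and the bound on the nonnegative integral has to be transferred
    to it.\<close>
  have f_bound: "(\<integral>\<^sup>+\<omega>. ennreal (norm (f n \<omega>)) \<partial>P) \<le> ennreal a"
    using a(2) f(2) nn_integral_cong[of P "\<lambda>\<omega>. ennreal (norm (f n \<omega>))" "\<lambda>\<omega>. ennreal (f n \<omega>)"]
    by (simp add: nonneg_process_def)
  have f_int: "integrable P (f n)"
    using f(1) f_bound by (intro integrableI_bounded) (auto intro: le_less_trans)
  have "ennreal (\<integral>\<omega>. f n \<omega> \<partial>P) \<le> ennreal a"
    using a(2) f(2) nn_integral_eq_integral[OF f_int]
    by (simp add: nonneg_process_def)
  then have f_le: "(\<integral>\<omega>. f n \<omega> \<partial>P) \<le> a"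
    using a(1) by simp
  \<comment> \<open>The pathwise lemma needs all indices at the same point; countably many
    exceptional null sets are merged into one.\<close>
  have "AE \<omega> in P. \<forall>k. W k \<omega> \<le> f k \<omega> + (\<Sum>j<k. B j \<omega> * (M (Suc j) \<omega> - M j \<omega>))"
    using le by (simp add: AE_all_countable)
  then have "AE \<omega> in P. x * indicator E \<omega> \<le> f n \<omega> + N \<omega>"
    using AE_space
  proof eventually_elim
    case (elim \<omega>)
    have "(if \<exists>k\<le>n. x \<le> W k \<omega> then x else 0) \<le> f n \<omega> + (\<Sum>k<n.
        (if \<forall>j\<le>k. W j \<omega> < x then B k \<omega> * (M (Suc k) \<omega> - M k \<omega>) else 0))"
      using elim W(2) f(3) by (intro stopped_sum_bound) (auto simp: nonneg_process_def)
    moreover have "(if \<forall>j\<le>k. W j \<omega> < x then B k \<omega> * (M (Suc k) \<omega> - M k \<omega>) else 0)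
        = h k \<omega> * (M (Suc k) \<omega> - M k \<omega>)" for k
      unfolding h_def by (simp only: if_distribR mult_zero_left split: if_split) blast
    moreover have "x * indicator E \<omega> = (if \<exists>k\<le>n. x \<le> W k \<omega> then x else 0)"
      using elim by (simp add: E_def indicator_def)
    ultimately show ?case
      by (simp only: N_def)
  qed
  then have "(\<integral>\<omega>. x * indicator E \<omega> \<partial>P) \<le> (\<integral>\<omega>. f n \<omega> + N \<omega> \<partial>P)"
    using f_int N(1) by (intro integral_mono_AE) (auto simp: less_top[symmetric])
  also have "\<dots> \<le> a"
    using f_int N f_le by simp
  finally have "prob E \<le> a / x"
    using x by (simp add: pos_le_divide_eq mult.commute)
  then show ?thesis
    unfolding E_def[symmetric] by (simp add: emeasure_eq_measure ennreal_leI)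
qed


section \<open>Finite maxima and the weak-type estimate\<close>

text \<open>The supremum of finitely many reals is attained. This turns the event that a running
  maximum reaches a level into the event of a first passage.\<close>

lemma le_SUP_atMost_iff:
  fixes f :: "nat \<Rightarrow> real"
  shows "x \<le> (SUP k\<in>{..n}. f k) \<longleftrightarrow> (\<exists>k\<le>n. x \<le> f k)"
  by (simp add: cSup_eq_Max Max_ge_iff Bex_def)

lemma SUP_atMost_upper:
  fixes f :: "nat \<Rightarrow> real"
  assumes "k \<le> n"
  shows "f k \<le> (SUP k\<in>{..n}. f k)"
  using assms le_SUP_atMost_iff by blast

lemma SUP_atMost_measurable:
  fixes f :: "nat \<Rightarrow> 'a \<Rightarrow> real"
  assumes "\<And>k. f k \<in> borel_measurable M"
  shows "(\<lambda>\<omega>. SUP k\<in>{..n}. f k \<omega>) \<in> borel_measurable M"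
  using assms by (intro borel_measurable_cSUP) auto

text \<open>The maximal inequality for \<open>X / A\<close>, where \<open>A\<close> is the product
  of the factors \<open>1 + G\<close>. The running maximum of \<open>F\<close> supplies the monotone
  term, and the weights \<open>1 / A (Suc k)\<close> lie in the unit interval as \<open>G\<close> is
  nonnegative.\<close>

lemma discounted_gronwall_weak_bound:
  assumes P: "filtered_prob_space P Fil" and M: "martingale_process P Fil M"
    and M0: "AE \<omega> in P. M 0 \<omega> = 0"
    and X: "adapted_process Fil X" "nonneg_process P X"
    and F: "adapted_process Fil F" "nonneg_process P F"
    and G: "adapted_process Fil G" "nonneg_process P G"
    and le: "\<And>n. AE \<omega> in P. X n \<omega> \<le> F n \<omega> + M n \<omega> + (\<Sum>k<n. G k \<omega> * X k \<omega>)"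
    and a: "0 \<le> a" "(\<integral>\<^sup>+\<omega>. ennreal (SUP k\<in>{..n}. F k \<omega>) \<partial>P) \<le> ennreal a" and x: "0 < x"
  shows "emeasure P {\<omega> \<in> space P. x \<le> (SUP k\<in>{..n}. X k \<omega> / (\<Prod>j<k. 1 + G j \<omega>))} \<le> ennreal (a / x)"
proof -
  define A where "A k \<omega> = (\<Prod>j<k. 1 + G j \<omega>)" for k \<omega>
  define f where "f m \<omega> = (SUP k\<in>{..m}. F k \<omega>)" for m \<omega>
  have A1: "1 \<le> A k \<omega>" if "\<omega> \<in> space P" for k \<omega>
    using G(2) that unfolding A_def by (intro prod_ge_1) (auto simp: nonneg_process_def)
  \<comment> \<open>The index shift matters: \<open>A (Suc m)\<close> involves only
    \<open>G 0\<close> to \<open>G m\<close> and is therefore known at time \<open>m\<close>, so it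
    can discount the martingale increment from \<open>m\<close> to \<open>m + 1\<close>.\<close>
  have A_meas: "A k \<in> borel_measurable (Fil m)" if "k \<le> Suc m" for k m
  proof -
    have "G j \<in> borel_measurable (Fil m)" if "j < k" for j
      using that \<open>k \<le> Suc m\<close> by (intro adapted_process_measurable(2)[OF P G(1)]) auto
    then show ?thesis
      unfolding A_def by (intro borel_measurable_prod borel_measurable_add) auto
  qed
  have f_mono: "mono (\<lambda>m. f m \<omega>)" for \<omega>
    unfolding f_def by (intro monoI cSUP_subset_mono) auto
  have f0: "0 \<le> f m \<omega>" if "\<omega> \<in> space P" for m \<omega>
    using F(2) that unfolding f_def le_SUP_atMost_iff by (auto simp: nonneg_process_def)
  have "emeasure P {\<omega> \<in> space P. \<exists>k\<le>n. x \<le> X k \<omega> / A k \<omega>} \<le> ennreal (a / x)"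
  proof (rule maximal_inequality[OF P M, where f = f and B = "\<lambda>k \<omega>. 1 / A (Suc k) \<omega>"])
    show "adapted_process Fil (\<lambda>k \<omega>. X k \<omega> / A k \<omega>)"
      using X(1) A_meas unfolding adapted_process_def by (auto intro!: borel_measurable_divide)
    show "nonneg_process P (\<lambda>k \<omega>. X k \<omega> / A k \<omega>)"
      using X(2) A1 unfolding nonneg_process_def
      by (auto intro!: divide_nonneg_nonneg intro: order_trans[OF zero_le_one])
    show "adapted_process Fil (\<lambda>k \<omega>. 1 / A (Suc k) \<omega>)"
      using A_meas unfolding adapted_process_def by (auto intro!: borel_measurable_divide)
    show "\<bar>1 / A (Suc k) \<omega>\<bar> \<le> 1" if "\<omega> \<in> space P" for k \<omega>
      using A1[OF that, of "Suc k"] by (simp add: divide_le_eq)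
    show "f n \<in> borel_measurable P"
      unfolding f_def by (intro SUP_atMost_measurable adapted_process_measurable[OF P F(1)])
    show "nonneg_process P f"
      using f0 by (simp add: nonneg_process_def)
    have "AE \<omega> in P. \<forall>n. X n \<omega> \<le> F n \<omega> + M n \<omega> + (\<Sum>k<n. G k \<omega> * X k \<omega>)"
      using le by (simp add: AE_all_countable)
    then show "AE \<omega> in P. X k \<omega> / A k \<omega>
        \<le> f k \<omega> + (\<Sum>j<k. 1 / A (Suc j) \<omega> * (M (Suc j) \<omega> - M j \<omega>))" for k
      using M0 AE_space
    proof eventually_elim
      case (elim \<omega>)
      have "X m \<omega> \<le> f m \<omega> + M m \<omega> + (\<Sum>k<m. G k \<omega> * X k \<omega>)" for m
      proof -
        have "X m \<omega> \<le> F m \<omega> + M m \<omega> + (\<Sum>k<m. G k \<omega> * X k \<omega>)"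
          using elim by blast
        moreover have "F m \<omega> \<le> f m \<omega>"
          unfolding f_def by (rule SUP_atMost_upper) simp
        ultimately show ?thesis
          by linarith
      qed
      then show ?case
        unfolding A_def using elim G(2) f_mono
        by (intro discounted_gronwall) (auto simp: nonneg_process_def)
    qed
    show "(\<integral>\<^sup>+\<omega>. ennreal (f n \<omega>) \<partial>P) \<le> ennreal a"
      using a(2) by (simp add: f_def)
  qed (use a x f_mono in auto)
  then show ?thesis
    by (simp add: le_SUP_atMost_iff A_def)
qed

section \<open>Norms with extended exponents\<close>

text \<open>Total mass 1 makes the norm of a function bounded below by 1 at least 1. Applied to the
  product of the \<open>(1 + G k) powr p\<close>, this excludes a vanishing norm in the final
  estimate.\<close>

lemma Lp_norm_ge_1:
  assumes "prob_space P" and [measurable]: "f \<in> borel_measurable P"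
    and f: "\<And>\<omega>. \<omega> \<in> space P \<Longrightarrow> 1 \<le> f \<omega>"
  shows "1 \<le> Lp_norm P \<mu> f"
proof -
  interpret prob_space P by fact
  show ?thesis
  proof (cases "\<mu> = \<infinity>")
    case True
    have "AE \<omega> in P. ennreal \<bar>f \<omega>\<bar> \<le> Lp_norm P \<mu> f"
      using esssup_AE[of "\<lambda>\<omega>. ennreal \<bar>f \<omega>\<bar>" P] True by (simp add: Lp_norm_def)
    \<comment> \<open>The inequality no longer depends on the point; since a probability measure is
      not null, holding almost everywhere means holding.\<close>
    then have "AE \<omega> in P. 1 \<le> Lp_norm P \<mu> f"
      using AE_space
    proof eventually_elim
      case (elim \<omega>)
      have "(1::ennreal) \<le> ennreal \<bar>f \<omega>\<bar>"
        using f[OF elim(2)] by (simp flip: ennreal_1)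
      then show ?case
        using elim(1) by (rule order_trans)
    qed
    then show ?thesis
      by simp
  next
    case False
    define I where "I = (\<integral>\<^sup>+\<omega>. ennreal (\<bar>f \<omega>\<bar> powr enn2real \<mu>) \<partial>P)"
    have "(\<integral>\<^sup>+\<omega>. 1 \<partial>P) \<le> I"
      unfolding I_def
    proof (intro nn_integral_mono)
      fix \<omega> assume "\<omega> \<in> space P"
      then show "1 \<le> ennreal (\<bar>f \<omega>\<bar> powr enn2real \<mu>)"
        using f[of \<omega>] by (simp add: ge_one_powr_ge_zero flip: ennreal_1)
    qed
    then have "1 \<le> I"
      by (simp add: emeasure_space_1)
    then have "1 \<le> ennreal_powr I (1 / enn2real \<mu>)"
      by (cases I) (auto simp: ennreal_powr_def ge_one_powr_ge_zero simp flip: ennreal_1)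
    then show ?thesis
      using False by (simp add: Lp_norm_def I_def)
  qed
qed

text \<open>If \<open>\<mu>\<close> is infinite, then \<open>v = 1\<close> and \<open>f\<close> is
  essentially bounded by \<open>a\<close>. Otherwise both exponents are finite and the real version
  of Hoelder's inequality applies.\<close>

lemma Lp_norm_Hoelder_bound:
  fixes f g :: "'a \<Rightarrow> real"
  assumes [measurable]: "f \<in> borel_measurable M" "g \<in> borel_measurable M"
    and nonneg: "\<And>x. x \<in> space M \<Longrightarrow> 0 \<le> f x" "\<And>x. x \<in> space M \<Longrightarrow> 0 \<le> g x"
    and \<mu>: "1 \<le> \<mu>" and v: "1 \<le> v" and conj: "1 / \<mu> + 1 / ennreal v = 1"
    and a: "0 < a" "Lp_norm M \<mu> f = ennreal a"
    and b: "0 < b" "(\<integral>\<^sup>+x. ennreal (g x powr v) \<partial>M) \<le> ennreal (b powr v)"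
  shows "(\<integral>\<^sup>+x. ennreal (f x * g x) \<partial>M) \<le> ennreal (a * b)"
proof (cases "\<mu> = \<infinity>")
  case True
  then have "v = 1"
    using conj v by (simp add: divide_ennreal flip: ennreal_1)
  have "AE x in M. ennreal \<bar>f x\<bar> \<le> ennreal a"
    using esssup_AE[of "\<lambda>x. ennreal \<bar>f x\<bar>" M] True a by (simp add: Lp_norm_def)
  then have "AE x in M. ennreal (f x * g x) \<le> ennreal a * ennreal (g x powr v)"
    using AE_space
  proof eventually_elim
    case (elim x)
    then have "f x * g x \<le> a * g x"
      using a nonneg[of x] by (intro mult_right_mono) auto
    then show ?case
      using a nonneg[of x] elim by (simp add: \<open>v = 1\<close> ennreal_leI flip: ennreal_mult)
  qed
  then have "(\<integral>\<^sup>+x. ennreal (f x * g x) \<partial>M) \<le> (\<integral>\<^sup>+x. ennreal a * ennreal (g x powr v) \<partial>M)"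
    by (rule nn_integral_mono_AE)
  also have "\<dots> = ennreal a * (\<integral>\<^sup>+x. ennreal (g x powr v) \<partial>M)"
    by (simp add: nn_integral_cmult)
  also have "\<dots> \<le> ennreal a * ennreal (b powr v)"
    using b by (intro mult_left_mono) auto
  finally show ?thesis
    using a b by (simp add: \<open>v = 1\<close> ennreal_mult)
next
  case False
  then obtain u where u: "\<mu> = ennreal u" "0 \<le> u"
    by (cases \<mu>) auto
  have "1 \<le> u"
    using \<mu> u by (simp flip: ennreal_1)
  then have "ennreal (1 / u + 1 / v) = 1"
    using conj v u by (simp add: divide_ennreal flip: ennreal_1)
  then have uv: "1 / u + 1 / v = 1"
    by simp
  \<comment> \<open>Both reciprocals are positive because \<open>u\<close> and \<open>v\<close> are
    finite, so neither can be 1; hence both exponents exceed 1.\<close>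
  have "1 / u < 1" "1 / v < 1"
    using uv v \<open>1 \<le> u\<close> by (smt (verit) divide_pos_pos)+
  then have "1 < u" "1 < v"
    using v \<open>1 \<le> u\<close> by (simp_all add: divide_less_eq)
  define I where "I = (\<integral>\<^sup>+x. ennreal (f x powr u) \<partial>M)"
  have "I = (\<integral>\<^sup>+x. ennreal (\<bar>f x\<bar> powr u) \<partial>M)"
    unfolding I_def using nonneg by (intro nn_integral_cong) simp
  then have I: "ennreal_powr I (1 / u) = ennreal a"
    using a(2) u by (simp add: Lp_norm_def)
  then obtain i where i: "I = ennreal i" "0 \<le> i"
    by (cases I) (auto simp: ennreal_powr_def)
  have "i powr (1 / u) = a"
    using I i a(1) by (simp add: ennreal_powr_def)
  then have "i = a powr u"
    using i \<open>1 < u\<close> by (auto simp: powr_powr)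
  then show ?thesis
    using uv \<open>1 < u\<close> \<open>1 < v\<close> a b nonneg i unfolding I_def
    by (intro Hoelder_bound[where u = u and v = v]) auto
qed

section \<open>Assembly of the moment estimate\<close>

lemma stochastic_gronwall:
  assumes P: "filtered_prob_space P Fil" and M: "martingale_process P Fil M"
    and M0: "AE \<omega> in P. M 0 \<omega> = 0"
    and X: "adapted_process Fil X" "nonneg_process P X"
    and F: "adapted_process Fil F" "nonneg_process P F"
    and G: "adapted_process Fil G" "nonneg_process P G"
    and le: "\<And>n. AE \<omega> in P. X n \<omega> \<le> F n \<omega> + M n \<omega> + (\<Sum>k<n. G k \<omega> * X k \<omega>)"
    and p: "0 < p" "p < 1" and \<mu>: "1 \<le> \<mu>" and \<nu>: "1 \<le> \<nu>" and conj: "1 / \<mu> + 1 / \<nu> = 1"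
    and p\<nu>: "ennreal p * \<nu> < 1"
  shows "(\<integral>\<^sup>+\<omega>. ennreal (SUP k\<in>{..n}. X k \<omega> powr p) \<partial>P)
    \<le> ennreal ((1 + 1 / (1 - enn2real \<nu> * p)) powr (1 / enn2real \<nu>))
      * Lp_norm P \<mu> (\<lambda>\<omega>. \<Prod>k<n. (1 + G k \<omega>) powr p)
      * ennreal_powr (\<integral>\<^sup>+\<omega>. ennreal (SUP k\<in>{..n}. F k \<omega>) \<partial>P) p"
proof -
  have prob: "prob_space P"
    using P by (simp add: filtered_prob_space_def)
  interpret prob_space P by fact
  \<comment> \<open>A positive \<open>p\<close> times infinity is not below 1, so
    \<open>\<nu>\<close> is a real number \<open>v\<close>.\<close>
  have "\<nu> \<noteq> \<infinity>"
    using p\<nu> p by (auto simp: ennreal_mult_top)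
  then obtain v where v: "\<nu> = ennreal v" "0 \<le> v"
    by (cases \<nu>) auto
  have "1 \<le> v"
    using \<nu> v by (simp flip: ennreal_1)
  have pv: "v * p < 1"
    using p\<nu> v p by (simp add: mult.commute ennreal_less_iff flip: ennreal_1 ennreal_mult)
  define C where "C = (1 + 1 / (1 - v * p)) powr (1 / v)"
  define I where "I = (\<integral>\<^sup>+\<omega>. ennreal (SUP k\<in>{..n}. F k \<omega>) \<partial>P)"
  define A where "A k \<omega> = (\<Prod>j<k. 1 + G j \<omega>)" for k \<omega>
  define W where "W k \<omega> = X k \<omega> / A k \<omega>" for k \<omega>
  define S where "S \<omega> = (SUP k\<in>{..n}. W k \<omega>)" for \<omega>
  define D where "D \<omega> = (\<Prod>k<n. (1 + G k \<omega>) powr p)" for \<omega>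
  have "0 < 1 + 1 / (1 - v * p)"
    using pv by (intro add_pos_nonneg) auto
  then have C: "0 < C"
    by (simp add: C_def)
  have [measurable]: "X k \<in> borel_measurable P" for k
    by (rule adapted_process_measurable(1)[OF P X(1)])
  have [measurable]: "G k \<in> borel_measurable P" for k
    by (rule adapted_process_measurable(1)[OF P G(1)])
  have [measurable]: "W k \<in> borel_measurable P" for k
    unfolding W_def[abs_def] A_def[abs_def] by measurable
  have [measurable]: "S \<in> borel_measurable P"
    unfolding S_def[abs_def] by (intro SUP_atMost_measurable) measurable
  have [measurable]: "D \<in> borel_measurable P"
    unfolding D_def[abs_def] by measurable
  have G0: "0 \<le> G k \<omega>" and X0: "0 \<le> X k \<omega>" if "\<omega> \<in> space P" for k \<omega>
    using that G(2) X(2) by (simp_all add: nonneg_process_def)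
  have A1: "1 \<le> A k \<omega>" if "\<omega> \<in> space P" for k \<omega>
    using G0[OF that] unfolding A_def by (intro prod_ge_1) auto
  have A_mono: "A k \<omega> \<le> A n \<omega>" if "\<omega> \<in> space P" "k \<le> n" for k \<omega>
    unfolding A_def using G0[OF that(1)] that(2) by (intro prod_mono2) auto
  have D_eq: "D \<omega> = A n \<omega> powr p" if "\<omega> \<in> space P" for \<omega>
    unfolding D_def A_def by (rule prod_powr_distrib[symmetric])
  have D1: "1 \<le> D \<omega>" if "\<omega> \<in> space P" for \<omega>
    using D_eq[OF that] A1[OF that] p by (simp add: ge_one_powr_ge_zero)
  have W0: "0 \<le> W k \<omega>" if "\<omega> \<in> space P" for k \<omega>
    using X0[OF that, of k] A1[OF that, of k] by (simp add: W_def)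
  have S0: "0 \<le> S \<omega>" if "\<omega> \<in> space P" for \<omega>
    using W0[OF that] unfolding S_def le_SUP_atMost_iff by blast
  \<comment> \<open>Since \<open>A\<close> increases in its index, \<open>A n\<close> serves as a
    common factor for all \<open>k \<le> n\<close>, and its power \<open>D\<close> can be taken out
    of the maximum.\<close>
  have X_le: "(SUP k\<in>{..n}. X k \<omega> powr p) \<le> D \<omega> * S \<omega> powr p" if "\<omega> \<in> space P" for \<omega>
  proof (intro cSUP_least)
    fix k assume "k \<in> {..n}"
    then have k: "k \<le> n" by simp
    have "X k \<omega> = A k \<omega> * W k \<omega>"
      using A1[OF that, of k] by (simp add: W_def)
    also have "\<dots> \<le> A n \<omega> * S \<omega>"
      using A_mono[OF that k] A1[OF that, of n] W0[OF that] SUP_atMost_upper[OF k, of "\<lambda>k. W k \<omega>"]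
      by (intro mult_mono) (auto simp: S_def)
    finally have "X k \<omega> powr p \<le> (A n \<omega> * S \<omega>) powr p"
      using X0[OF that] p by (intro powr_mono2) auto
    then show "X k \<omega> powr p \<le> D \<omega> * S \<omega> powr p"
      using D_eq[OF that] A1[OF that, of n] S0[OF that] by (simp add: powr_mult)
  qed simp
  have tail: "emeasure P {\<omega> \<in> space P. x \<le> S \<omega>} \<le> ennreal (a / x)"
    if "0 < x" "0 \<le> a" "I \<le> ennreal a" for x a
    using discounted_gronwall_weak_bound[OF P M M0 X F G le, of a n x] that
    by (simp add: I_def S_def W_def A_def)
  have Lp1: "1 \<le> Lp_norm P \<mu> D"
    by (intro Lp_norm_ge_1 prob D1) measurable
  have "(\<integral>\<^sup>+\<omega>. ennreal (SUP k\<in>{..n}. X k \<omega> powr p) \<partial>P)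
      \<le> (\<integral>\<^sup>+\<omega>. ennreal (D \<omega> * S \<omega> powr p) \<partial>P)"
    by (intro nn_integral_mono ennreal_leI X_le)
  also have "\<dots> \<le> ennreal C * Lp_norm P \<mu> D * ennreal_powr I p"
  proof -
    \<comment> \<open>Zero times infinity is zero here, so \<open>I = 0\<close> makes the right-hand
      side vanish even for an infinite norm and needs its own argument. Otherwise an infinite factor
      makes the claim trivial, and the rest is finite and positive.\<close>
    consider "I = 0" | "I = \<infinity> \<or> Lp_norm P \<mu> D = \<infinity> \<and> I \<noteq> 0"
      | a l where "I = ennreal a" "0 < a" "Lp_norm P \<mu> D = ennreal l" "0 \<le> l"
      by (cases I; cases "Lp_norm P \<mu> D") (auto simp: less_le)
    then show ?thesis
    proof cases
      case 1
      \<comment> \<open>With \<open>a = 0\<close> the weak bound says that \<open>S\<close> almost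
        surely reaches no positive level; the levels \<open>1 / real (Suc i)\<close> are countable
        and exhaust them.\<close>
      have "AE \<omega> in P. \<not> 1 / real (Suc i) \<le> S \<omega>" for i
        using tail[of "1 / real (Suc i)" 0] 1
        by (intro AE_I[where N = "{\<omega> \<in> space P. 1 / real (Suc i) \<le> S \<omega>}"]) auto
      then have "AE \<omega> in P. \<forall>i. \<not> 1 / real (Suc i) \<le> S \<omega>"
        by (simp add: AE_all_countable)
      then have "AE \<omega> in P. ennreal (D \<omega> * S \<omega> powr p) = 0"
        using AE_space
      proof eventually_elim
        case (elim \<omega>)
        then have "\<not> 0 < S \<omega>"
          using nat_approx_posE[of "S \<omega>"] by (metis less_imp_le)
        then show ?case
          using S0[OF elim(2)] by simp
      qed
      then have "(\<integral>\<^sup>+\<omega>. ennreal (D \<omega> * S \<omega> powr p) \<partial>P) = 0"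
        by (subst nn_integral_cong_AE[of _ "\<lambda>_. 0"]) auto
      then show ?thesis
        by simp
    next
      case 2
      \<comment> \<open>No factor vanishes, so the infinite one is not cancelled.\<close>
      have "ennreal C \<noteq> 0" "Lp_norm P \<mu> D \<noteq> 0"
        using C Lp1 by auto
      moreover have "ennreal_powr I p \<noteq> 0" if "I \<noteq> 0"
        using that by (cases I) (auto simp: ennreal_powr_def)
      ultimately have "ennreal C * Lp_norm P \<mu> D * ennreal_powr I p = \<infinity>"
        using 2 by (auto simp: ennreal_powr_def ennreal_mult_eq_top_iff)
      then show ?thesis
        by simp
    next
      case (3 a l)
      have "1 \<le> l"
        using 3 Lp1 by (simp flip: ennreal_1)
      \<comment> \<open>\<open>b\<close> bounds the norm of \<open>S powr p\<close> with exponent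
        \<open>v\<close>: \<open>b powr v\<close> is the moment bound with
        \<open>q = v * p\<close>.\<close>
      define b where "b = (a powr (v * p) / (1 - v * p)) powr (1 / v)"
      have "b powr v = a powr (v * p) / (1 - v * p)"
        using \<open>1 \<le> v\<close> pv by (simp add: b_def powr_powr)
      moreover have "(\<integral>\<^sup>+\<omega>. ennreal (S \<omega> powr (v * p)) \<partial>P)
          \<le> ennreal (a powr (v * p) / (1 - v * p))"
        using 3 p \<open>1 \<le> v\<close> pv S0 by (intro nn_integral_powr_le_of_weak_bound prob tail) auto
      ultimately have b: "(\<integral>\<^sup>+\<omega>. ennreal ((S \<omega> powr p) powr v) \<partial>P) \<le> ennreal (b powr v)"
        by (simp add: powr_powr mult.commute)
      have "(\<integral>\<^sup>+\<omega>. ennreal (D \<omega> * S \<omega> powr p) \<partial>P) \<le> ennreal (l * b)"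
      proof (rule Lp_norm_Hoelder_bound[OF _ _ _ _ \<mu> \<open>1 \<le> v\<close>])
        show "0 < b"
          using 3 pv by (simp add: b_def)
        show "0 \<le> D \<omega>" if "\<omega> \<in> space P" for \<omega>
          using D1[OF that] by simp
      qed (use conj v \<open>1 \<le> l\<close> 3 b in auto)
      also have "b \<le> C * a powr p"
      proof -
        have "b = (1 / (1 - v * p)) powr (1 / v) * a powr p"
          using pv 3 \<open>1 \<le> v\<close> powr_mult[of "1 / (1 - v * p)" "a powr (v * p)" "1 / v"]
          by (simp add: b_def powr_powr)
        \<comment> \<open>Integrating the tail gives \<open>1 / (1 - v * p)\<close>; the stated
          constant adds 1 inside the power and is larger.\<close>
        moreover have "(1 / (1 - v * p)) powr (1 / v) \<le> C"
          unfolding C_def using pv \<open>1 \<le> v\<close> by (intro powr_mono2) auto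
        ultimately show ?thesis
          by (simp add: mult_right_mono)
      qed
      then have "ennreal (l * b) \<le> ennreal (l * (C * a powr p))"
        using 3 by (intro ennreal_leI mult_left_mono) auto
      also have "\<dots> = ennreal C * Lp_norm P \<mu> D * ennreal_powr I p"
        using 3 C by (simp add: ennreal_powr_def mult_ac flip: ennreal_mult)
      finally show ?thesis .
    qed
  qed
  finally show ?thesis
    using v by (simp add: C_def D_def[abs_def] I_def)
qed

section \<open>The general estimate and its deterministic case\<close>

theorem theorem1:
  fixes P :: "'a measure" and Fil :: "nat \<Rightarrow> 'a measure"
    and M X F G :: "nat \<Rightarrow> 'a \<Rightarrow> real"
  assumes "filtered_prob_space P Fil"
    and "martingale_process P Fil M"
    and "AE \<omega> in P. M 0 \<omega> = 0"
    and "adapted_process Fil X" and "nonneg_process P X"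
    and "adapted_process Fil F" and "nonneg_process P F"
    and "adapted_process Fil G" and "nonneg_process P G"
    and "(\<integral>\<^sup>+\<omega>. ennreal (X 0 \<omega>) \<partial>P) < \<infinity>"
    and "\<And>n. AE \<omega> in P. X n \<omega> \<le> F n \<omega> + M n \<omega> + (\<Sum>k<n. G k \<omega> * X k \<omega>)"
  shows "(\<forall>(p::real) (\<mu>::ennreal) (\<nu>::ennreal).
            0 < p \<and> p < 1 \<and> 1 \<le> \<mu> \<and> 1 \<le> \<nu> \<and> 1 / \<mu> + 1 / \<nu> = 1 \<and> ennreal p * \<nu> < 1 \<longrightarrow>
            (\<forall>n. (\<integral>\<^sup>+\<omega>. ennreal (SUP k\<in>{..n}. X k \<omega> powr p) \<partial>P)
               \<le> ennreal ((1 + 1 / (1 - enn2real \<nu> * p)) powr (1 / enn2real \<nu>))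
                 * Lp_norm P \<mu> (\<lambda>\<omega>. \<Prod>k<n. (1 + G k \<omega>) powr p)
                 * ennreal_powr (\<integral>\<^sup>+\<omega>. ennreal (SUP k\<in>{..n}. F k \<omega>) \<partial>P) p))
       \<and> (\<forall>g :: nat \<Rightarrow> real. (\<forall>k. \<forall>\<omega>\<in>space P. G k \<omega> = g k) \<longrightarrow>
            (\<forall>p::real. 0 < p \<and> p < 1 \<longrightarrow>
              (\<forall>n. (\<integral>\<^sup>+\<omega>. ennreal (SUP k\<in>{..n}. X k \<omega> powr p) \<partial>P)
                 \<le> ennreal (1 + 1 / (1 - p))
                   * ennreal (\<Prod>k<n. (1 + g k) powr p)
                   * ennreal_powr (\<integral>\<^sup>+\<omega>. ennreal (SUP k\<in>{..n}. F k \<omega>) \<partial>P) p)))"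
proof (intro conjI allI impI)
  fix p :: real and \<mu> \<nu> :: ennreal and n :: nat
  assume "0 < p \<and> p < 1 \<and> 1 \<le> \<mu> \<and> 1 \<le> \<nu> \<and> 1 / \<mu> + 1 / \<nu> = 1 \<and> ennreal p * \<nu> < 1"
  then show "(\<integral>\<^sup>+\<omega>. ennreal (SUP k\<in>{..n}. X k \<omega> powr p) \<partial>P)
    \<le> ennreal ((1 + 1 / (1 - enn2real \<nu> * p)) powr (1 / enn2real \<nu>))
      * Lp_norm P \<mu> (\<lambda>\<omega>. \<Prod>k<n. (1 + G k \<omega>) powr p)
      * ennreal_powr (\<integral>\<^sup>+\<omega>. ennreal (SUP k\<in>{..n}. F k \<omega>) \<partial>P) p"
    by (intro stochastic_gronwall[OF assms(1-9) assms(11)]) auto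
next
  fix g :: "nat \<Rightarrow> real" and p :: real and n :: nat
  assume g: "\<forall>k. \<forall>\<omega>\<in>space P. G k \<omega> = g k" and p: "0 < p \<and> p < 1"
  have [measurable]: "G k \<in> borel_measurable P" for k
    using adapted_process_measurable(1)[OF assms(1,8)] .
  \<comment> \<open>For deterministic \<open>G\<close> the pair of exponents infinity and 1 is used:
    the outer power of the constant disappears, and the essential supremum of a constant product is
    at most that product.\<close>
  have "(\<integral>\<^sup>+\<omega>. ennreal (SUP k\<in>{..n}. X k \<omega> powr p) \<partial>P)
      \<le> ennreal ((1 + 1 / (1 - enn2real 1 * p)) powr (1 / enn2real 1))
        * Lp_norm P \<infinity> (\<lambda>\<omega>. \<Prod>k<n. (1 + G k \<omega>) powr p)
        * ennreal_powr (\<integral>\<^sup>+\<omega>. ennreal (SUP k\<in>{..n}. F k \<omega>) \<partial>P) p"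
    using p by (intro stochastic_gronwall[OF assms(1-9) assms(11)]) (auto simp: ennreal_less_iff)
  also have "(1 + 1 / (1 - enn2real 1 * p)) powr (1 / enn2real 1) = 1 + 1 / (1 - p)"
    using p by (simp add: add_pos_nonneg)
  also have "Lp_norm P \<infinity> (\<lambda>\<omega>. \<Prod>k<n. (1 + G k \<omega>) powr p) \<le> ennreal (\<Prod>k<n. (1 + g k) powr p)"
    unfolding Lp_norm_def if_P[OF refl]
  proof (intro esssup_I AE_I2)
    fix \<omega> assume "\<omega> \<in> space P"
    then show "ennreal \<bar>\<Prod>k<n. (1 + G k \<omega>) powr p\<bar> \<le> ennreal (\<Prod>k<n. (1 + g k) powr p)"
      using g by (simp add: abs_of_nonneg prod_nonneg)
  qed measurable
  finally show "(\<integral>\<^sup>+\<omega>. ennreal (SUP k\<in>{..n}. X k \<omega> powr p) \<partial>P)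
      \<le> ennreal (1 + 1 / (1 - p)) * ennreal (\<Prod>k<n. (1 + g k) powr p)
        * ennreal_powr (\<integral>\<^sup>+\<omega>. ennreal (SUP k\<in>{..n}. F k \<omega>) \<partial>P) p"
    by (simp add: mult_left_mono mult_right_mono)
qed

end
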